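(* Let $\mathcal T$ be a rigidly-compactly generated tensor-triangulated category with $\mathrm{Spc}(\mathcal T^c)$ weakly noetherian. If $\mathcal T$ is stratified then $$\mathrm{Supp}(t_1\otimes t_2)=\mathrm{Supp}(t_1)\cap\mathrm{Supp}(t_2)$$ for any $t_1,t_2\in\mathcal T$.
   Context: A tensor-triangulated category is a triangulated category with a compatible closed symmetric monoidal structure $(\otimes,\mathbb 1)$; it is rigidly-compactly generated if it is compactly generated (in particular has all small coproducts) and its compact objects coincide with its dualizable objects. $\mathcal T^c$ is the full subcategory of compact objects. A localizing $\otimes$-ideal is a triangulated subcategory closed under coproducts and under tensoring with arbitrary objects; $\mathrm{Loc}_\otimes\langle\mathcal E\rangle$ is the smallest one containing $\mathcal E$; it is minimal if nonzero and containing no localizing $\otimes$-ideals other than $0$ and itself. $\mathrm{Spc}(\mathcal T^c)$ is the Balmer spectrum: the set of prime thick $\otimes$-ideals of $\mathcal T^c$, with the sets $\mathrm{supp}(x)=\{\mathcal P : x\notin\mathcal P\}$, $x\in\mathcal T^c$, as a basis of closed sets; it is a spectral space. A subset of a spectral space is Thomason if it is a union of closed subsets each with quasi-compact complement. For $Y\subseteq\mathrm{Spc}(\mathcal T^c)$ Thomason put $\mathcal T^c_Y=\{x\in\mathcal T^c:\mathrm{supp}(x)\subseteq Y\}$; there is an (essentially unique) exact triangle $e_Y\to\mathbb 1\to f_Y\to\Sigma e_Y$ with $e_Y\otimes f_Y=0$ and $\mathrm{Loc}_\otimes\langle e_Y\rangle=\mathrm{Ker}(f_Y\otimes-)=\mathrm{Loc}\langle\mathcal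 T^c_Y\rangle$. A spectral space is weakly noetherian if for every point $\mathcal P$ there are Thomason $Y_1,Y_2$ with $\{\mathcal P\}=Y_1\cap Y_2^c$; then $g(\mathcal P)=e_{Y_1}\otimes f_{Y_2}$ (independent of choices) and $\mathrm{Supp}(t)=\{\mathcal P\in\mathrm{Spc}(\mathcal T^c): g(\mathcal P)\otimes t\ne0\}$. $\mathcal T$ is stratified if $\mathrm{Loc}_\otimes\langle t\rangle=\mathrm{Loc}_\otimes\langle t\otimes g(\mathcal P)\mid \mathcal P\in\mathrm{Spc}(\mathcal T^c)\rangle$ for all $t\in\mathcal T$ and each $\mathrm{Loc}_\otimes\langle g(\mathcal P)\rangle$ is a minimal localizing $\otimes$-ideal; equivalently, $\mathcal L\mapsto\bigcup_{t\in\mathcal L}\mathrm{Supp}(t)$ is a bijection from localizing $\otimes$-ideals of $\mathcal T$ to subsets of $\mathrm{Spc}(\mathcal T^c)$. *)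

theory Defs
  imports
    "HOL-Analysis.Abstract_Topology"
    "HOL-Algebra.Free_Abelian_Groups"
begin

unbundle cardinal_syntax

section \<open>Preadditive categories\<close>

text \<open>
  The field \<open>univ\<close> is a cardinal fixing which sets are ``small'': a set is small if its
  cardinality is less than \<open>univ\<close>.  It plays no role until coproducts are considered, and is required
  to be inaccessible (i.e. to come from a Grothendieck universe) in the definition of a compactly
  generated category below.  Families are indexed by sets \<open>I :: 'u set\<close>; every set of cardinality
  less than \<open>univ\<close> is in bijection with such an \<open>I\<close>.

  Composition is written in the usual order: \<open>g \<cdot> f\<close> is ``\<open>g\<close> after \<open>f\<close>''.
  The fields are meaningful on \<open>Ob\<close> and \<open>Ar\<close> only.
\<close>

record ('u, 'o, 'm) cat =
  univ :: "'u rel"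
  Ob   :: "'o set"
  Ar   :: "'m set"
  src  :: "'m \<Rightarrow> 'o"
  tgt  :: "'m \<Rightarrow> 'o"
  idm  :: "'o \<Rightarrow> 'm"
  cmp  :: "'m \<Rightarrow> 'm \<Rightarrow> 'm"  (infixr "\<cdot>\<index>" 70)
  addm :: "'m \<Rightarrow> 'm \<Rightarrow> 'm"
  zerm :: "'o \<Rightarrow> 'o \<Rightarrow> 'm"

definition Hom :: "('u, 'o, 'm, 'z) cat_scheme \<Rightarrow> 'o \<Rightarrow> 'o \<Rightarrow> 'm set" where
  "Hom C x y = {f \<in> Ar C. src C f = x \<and> tgt C f = y}"

definition Hom_group :: "('u, 'o, 'm, 'z) cat_scheme \<Rightarrow> 'o \<Rightarrow> 'o \<Rightarrow> 'm monoid" where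
  "Hom_group C x y = \<lparr>carrier = Hom C x y, mult = addm C, one = zerm C x y\<rparr>"

definition negm :: "('u, 'o, 'm, 'z) cat_scheme \<Rightarrow> 'm \<Rightarrow> 'm" where
  "negm C f = m_inv (Hom_group C (src C f) (tgt C f)) f"

definition inverse_arrows :: "('u, 'o, 'm, 'z) cat_scheme \<Rightarrow> 'm \<Rightarrow> 'm \<Rightarrow> bool" where
  "inverse_arrows C f g \<longleftrightarrow>
     f \<in> Ar C \<and> g \<in> Hom C (tgt C f) (src C f) \<and>
     cmp C g f = idm C (src C f) \<and> cmp C f g = idm C (tgt C f)"

definition iso_arrow :: "('u, 'o, 'm, 'z) cat_scheme \<Rightarrow> 'o \<Rightarrow> 'o \<Rightarrow> 'm \<Rightarrow> bool" where
  "iso_arrow C x y f \<longleftrightarrow> f \<in> Hom C x y \<and> (\<exists>g. inverse_arrows C f g)"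

definition inv_arrow :: "('u, 'o, 'm, 'z) cat_scheme \<Rightarrow> 'm \<Rightarrow> 'm" where
  "inv_arrow C f = (THE g. inverse_arrows C f g)"

definition isomorphic :: "('u, 'o, 'm, 'z) cat_scheme \<Rightarrow> 'o \<Rightarrow> 'o \<Rightarrow> bool" where
  "isomorphic C x y \<longleftrightarrow> (\<exists>f. iso_arrow C x y f)"

definition zero_object :: "('u, 'o, 'm, 'z) cat_scheme \<Rightarrow> 'o \<Rightarrow> bool" where
  "zero_object C z \<longleftrightarrow>
     z \<in> Ob C \<and> (\<forall>x\<in>Ob C. (\<exists>!f. f \<in> Hom C x z) \<and> (\<exists>!f. f \<in> Hom C z x))"

definition biproduct ::
  "('u, 'o, 'm, 'z) cat_scheme \<Rightarrow> 'o \<Rightarrow> 'o \<Rightarrow> 'o \<Rightarrow> 'm \<Rightarrow> 'm \<Rightarrow> 'm \<Rightarrow> 'm \<Rightarrow> bool" where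
  "biproduct C x y s i j p q \<longleftrightarrow>
     x \<in> Ob C \<and> y \<in> Ob C \<and> s \<in> Ob C \<and>
     i \<in> Hom C x s \<and> j \<in> Hom C y s \<and> p \<in> Hom C s x \<and> q \<in> Hom C s y \<and>
     cmp C p i = idm C x \<and> cmp C q j = idm C y \<and>
     cmp C q i = zerm C x y \<and> cmp C p j = zerm C y x \<and>
     addm C (cmp C i p) (cmp C j q) = idm C s"

locale category =
  fixes C :: "('u, 'o, 'm, 'z) cat_scheme" (structure)
  assumes src_Ob: "f \<in> Ar C \<Longrightarrow> src C f \<in> Ob C"
    and tgt_Ob: "f \<in> Ar C \<Longrightarrow> tgt C f \<in> Ob C"
    and idm_Hom: "x \<in> Ob C \<Longrightarrow> idm C x \<in> Hom C x x"
    and cmp_Hom: "\<lbrakk>f \<in> Hom C x y; g \<in> Hom C y z\<rbrakk> \<Longrightarrow> g \<cdot> f \<in> Hom C x z"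
    and cmp_idm: "f \<in> Hom C x y \<Longrightarrow> f \<cdot> idm C x = f"
    and idm_cmp: "f \<in> Hom C x y \<Longrightarrow> idm C y \<cdot> f = f"
    and cmp_assoc: "\<lbrakk>f \<in> Hom C w x; g \<in> Hom C x y; h \<in> Hom C y z\<rbrakk> \<Longrightarrow> (h \<cdot> g) \<cdot> f = h \<cdot> (g \<cdot> f)"

locale additive_category = category +
  assumes Hom_comm_group: "\<lbrakk>x \<in> Ob C; y \<in> Ob C\<rbrakk> \<Longrightarrow> comm_group (Hom_group C x y)"
    and cmp_addm_left: "\<lbrakk>f \<in> Hom C x y; g \<in> Hom C y z; h \<in> Hom C y z\<rbrakk>
          \<Longrightarrow> addm C g h \<cdot> f = addm C (g \<cdot> f) (h \<cdot> f)"
    and cmp_addm_right: "\<lbrakk>f \<in> Hom C x y; g \<in> Hom C x y; h \<in> Hom C y z\<rbrakk>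
          \<Longrightarrow> h \<cdot> addm C f g = addm C (h \<cdot> f) (h \<cdot> g)"
    and ex_zero_object: "\<exists>z. zero_object C z"
    and ex_biproduct: "\<lbrakk>x \<in> Ob C; y \<in> Ob C\<rbrakk> \<Longrightarrow> \<exists>s i j p q. biproduct C x y s i j p q"


section \<open>Triangulated categories\<close>

text \<open>
  \<open>sh\<close> and \<open>shm\<close> are the suspension \<open>\<Sigma>\<close> on objects and on arrows, and \<open>tri\<close> is the class of
  exact triangles, given by their three arrows.
\<close>

record ('u, 'o, 'm) tcat = "('u, 'o, 'm) cat" +
  sh  :: "'o \<Rightarrow> 'o"
  shm :: "'m \<Rightarrow> 'm"
  tri :: "('m \<times> 'm \<times> 'm) set"

definition exact_triangle ::
  "('u, 'o, 'm, 'z) tcat_scheme \<Rightarrow> 'o \<Rightarrow> 'o \<Rightarrow> 'o \<Rightarrow> 'm \<Rightarrow> 'm \<Rightarrow> 'm \<Rightarrow> bool" where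
  "exact_triangle C x y z u v w \<longleftrightarrow>
     u \<in> Hom C x y \<and> v \<in> Hom C y z \<and> w \<in> Hom C z (sh C x) \<and> (u, v, w) \<in> tri C"

text \<open>
  The axioms \<open>sh_Ob\<close> to \<open>sh_ess_surj\<close> say that the suspension is an additive self-equivalence; the
  remaining ones are Verdier's axioms TR1--TR4.
\<close>

locale triangulated_category = additive_category C
  for C :: "('u, 'o, 'm, 'z) tcat_scheme" (structure) +
  assumes sh_Ob: "x \<in> Ob C \<Longrightarrow> sh C x \<in> Ob C"
    and shm_idm: "x \<in> Ob C \<Longrightarrow> shm C (idm C x) = idm C (sh C x)"
    and shm_cmp: "\<lbrakk>f \<in> Hom C x y; g \<in> Hom C y z\<rbrakk> \<Longrightarrow> shm C (g \<cdot> f) = shm C g \<cdot> shm C f"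
    and shm_addm: "\<lbrakk>f \<in> Hom C x y; g \<in> Hom C x y\<rbrakk> \<Longrightarrow> shm C (addm C f g) = addm C (shm C f) (shm C g)"
    and shm_bij: "\<lbrakk>x \<in> Ob C; y \<in> Ob C\<rbrakk> \<Longrightarrow> bij_betw (shm C) (Hom C x y) (Hom C (sh C x) (sh C y))"
    and sh_ess_surj: "y \<in> Ob C \<Longrightarrow> \<exists>x\<in>Ob C. isomorphic C (sh C x) y"
    and tri_composable: "(u, v, w) \<in> tri C \<Longrightarrow> \<exists>x y z. exact_triangle C x y z u v w"
    and tri_iso: "\<lbrakk>exact_triangle C x y z u v w;
          u' \<in> Hom C x' y'; v' \<in> Hom C y' z'; w' \<in> Hom C z' (sh C x');
          iso_arrow C x x' a; iso_arrow C y y' b; iso_arrow C z z' c;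
          u' \<cdot> a = b \<cdot> u; v' \<cdot> b = c \<cdot> v; w' \<cdot> c = shm C a \<cdot> w\<rbrakk>
          \<Longrightarrow> (u', v', w') \<in> tri C"
    and tri_idm: "\<lbrakk>x \<in> Ob C; zero_object C z\<rbrakk>
          \<Longrightarrow> (idm C x, zerm C x z, zerm C z (sh C x)) \<in> tri C"
    and tri_cone: "u \<in> Hom C x y \<Longrightarrow> \<exists>z v w. exact_triangle C x y z u v w"
    and tri_rotate: "\<lbrakk>u \<in> Hom C x y; v \<in> Hom C y z; w \<in> Hom C z (sh C x)\<rbrakk>
          \<Longrightarrow> (u, v, w) \<in> tri C \<longleftrightarrow> (v, w, negm C (shm C u)) \<in> tri C"
    and tri_morphism: "\<lbrakk>exact_triangle C x y z u v w; exact_triangle C x' y' z' u' v' w';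
          a \<in> Hom C x x'; b \<in> Hom C y y'; u' \<cdot> a = b \<cdot> u\<rbrakk>
          \<Longrightarrow> \<exists>c\<in>Hom C z z'. v' \<cdot> b = c \<cdot> v \<and> w' \<cdot> c = shm C a \<cdot> w"
    and tri_octahedron: "\<lbrakk>exact_triangle C x y z' u j k; exact_triangle C y z x' v l i;
          exact_triangle C x z y' (v \<cdot> u) m n\<rbrakk>
          \<Longrightarrow> \<exists>f g. exact_triangle C z' y' x' f g (shm C j \<cdot> i) \<and>
                f \<cdot> j = m \<cdot> v \<and> n \<cdot> f = k \<and> g \<cdot> m = l \<and> i \<cdot> g = shm C u \<cdot> n"


section \<open>Tensor-triangulated categories\<close>

text \<open>
  \<open>tno\<close> and \<open>tna\<close> are the tensor product on objects and on arrows, \<open>ihom\<close> is the internal hom with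
  evaluation \<open>ev x y : ihom x y \<boxtimes> x \<rightarrow> y\<close>, and \<open>tsh x y : \<Sigma>x \<boxtimes> y \<rightarrow> \<Sigma>(x \<boxtimes> y)\<close> is the comparison of
  the tensor product with the suspension.
\<close>

record ('u, 'o, 'm) ttcat = "('u, 'o, 'm) tcat" +
  tno   :: "'o \<Rightarrow> 'o \<Rightarrow> 'o"  (infixr "\<boxtimes>\<index>" 75)
  tna   :: "'m \<Rightarrow> 'm \<Rightarrow> 'm"  (infixr "\<odot>\<index>" 75)
  tunit :: "'o"
  assoc :: "'o \<Rightarrow> 'o \<Rightarrow> 'o \<Rightarrow> 'm"
  lunit :: "'o \<Rightarrow> 'm"
  runit :: "'o \<Rightarrow> 'm"
  braid :: "'o \<Rightarrow> 'o \<Rightarrow> 'm"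
  ihom  :: "'o \<Rightarrow> 'o \<Rightarrow> 'o"
  ev    :: "'o \<Rightarrow> 'o \<Rightarrow> 'm"
  tsh   :: "'o \<Rightarrow> 'o \<Rightarrow> 'm"

locale closed_symmetric_monoidal = category C
  for C :: "('u, 'o, 'm, 'z) ttcat_scheme" (structure) +
  assumes tno_Ob: "\<lbrakk>x \<in> Ob C; y \<in> Ob C\<rbrakk> \<Longrightarrow> x \<boxtimes> y \<in> Ob C"
    and tna_Hom: "\<lbrakk>f \<in> Hom C x x'; g \<in> Hom C y y'\<rbrakk> \<Longrightarrow> f \<odot> g \<in> Hom C (x \<boxtimes> y) (x' \<boxtimes> y')"
    and tna_idm: "\<lbrakk>x \<in> Ob C; y \<in> Ob C\<rbrakk> \<Longrightarrow> idm C x \<odot> idm C y = idm C (x \<boxtimes> y)"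
    and tna_cmp: "\<lbrakk>f \<in> Hom C x x'; f' \<in> Hom C x' x''; g \<in> Hom C y y'; g' \<in> Hom C y' y''\<rbrakk>
          \<Longrightarrow> (f' \<cdot> f) \<odot> (g' \<cdot> g) = (f' \<odot> g') \<cdot> (f \<odot> g)"
    and tunit_Ob: "tunit C \<in> Ob C"
    and assoc_iso: "\<lbrakk>x \<in> Ob C; y \<in> Ob C; z \<in> Ob C\<rbrakk>
          \<Longrightarrow> iso_arrow C ((x \<boxtimes> y) \<boxtimes> z) (x \<boxtimes> (y \<boxtimes> z)) (assoc C x y z)"
    and assoc_natural: "\<lbrakk>f \<in> Hom C x x'; g \<in> Hom C y y'; h \<in> Hom C z z'\<rbrakk>
          \<Longrightarrow> assoc C x' y' z' \<cdot> ((f \<odot> g) \<odot> h) = (f \<odot> (g \<odot> h)) \<cdot> assoc C x y z"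
    and lunit_iso: "x \<in> Ob C \<Longrightarrow> iso_arrow C (tunit C \<boxtimes> x) x (lunit C x)"
    and lunit_natural: "f \<in> Hom C x y \<Longrightarrow> lunit C y \<cdot> (idm C (tunit C) \<odot> f) = f \<cdot> lunit C x"
    and runit_iso: "x \<in> Ob C \<Longrightarrow> iso_arrow C (x \<boxtimes> tunit C) x (runit C x)"
    and runit_natural: "f \<in> Hom C x y \<Longrightarrow> runit C y \<cdot> (f \<odot> idm C (tunit C)) = f \<cdot> runit C x"
    and braid_iso: "\<lbrakk>x \<in> Ob C; y \<in> Ob C\<rbrakk> \<Longrightarrow> iso_arrow C (x \<boxtimes> y) (y \<boxtimes> x) (braid C x y)"
    and braid_natural: "\<lbrakk>f \<in> Hom C x x'; g \<in> Hom C y y'\<rbrakk>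
          \<Longrightarrow> braid C x' y' \<cdot> (f \<odot> g) = (g \<odot> f) \<cdot> braid C x y"
    and pentagon: "\<lbrakk>w \<in> Ob C; x \<in> Ob C; y \<in> Ob C; z \<in> Ob C\<rbrakk>
          \<Longrightarrow> assoc C w x (y \<boxtimes> z) \<cdot> assoc C (w \<boxtimes> x) y z =
              (idm C w \<odot> assoc C x y z) \<cdot> assoc C w (x \<boxtimes> y) z \<cdot> (assoc C w x y \<odot> idm C z)"
    and triangle: "\<lbrakk>x \<in> Ob C; y \<in> Ob C\<rbrakk>
          \<Longrightarrow> (idm C x \<odot> lunit C y) \<cdot> assoc C x (tunit C) y = runit C x \<odot> idm C y"
    and hexagon: "\<lbrakk>x \<in> Ob C; y \<in> Ob C; z \<in> Ob C\<rbrakk>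
          \<Longrightarrow> assoc C y z x \<cdot> braid C x (y \<boxtimes> z) \<cdot> assoc C x y z =
              (idm C y \<odot> braid C x z) \<cdot> assoc C y x z \<cdot> (braid C x y \<odot> idm C z)"
    and braid_symmetric: "\<lbrakk>x \<in> Ob C; y \<in> Ob C\<rbrakk> \<Longrightarrow> braid C y x \<cdot> braid C x y = idm C (x \<boxtimes> y)"
    and ihom_Ob: "\<lbrakk>x \<in> Ob C; y \<in> Ob C\<rbrakk> \<Longrightarrow> ihom C x y \<in> Ob C"
    and ev_Hom: "\<lbrakk>x \<in> Ob C; y \<in> Ob C\<rbrakk> \<Longrightarrow> ev C x y \<in> Hom C (ihom C x y \<boxtimes> x) y"
    and ihom_universal: "\<lbrakk>x \<in> Ob C; y \<in> Ob C; z \<in> Ob C; f \<in> Hom C (z \<boxtimes> x) y\<rbrakk>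
          \<Longrightarrow> \<exists>!h. h \<in> Hom C z (ihom C x y) \<and> ev C x y \<cdot> (h \<odot> idm C x) = f"

text \<open>The arrow \<open>z \<rightarrow> ihom x y\<close> adjoint to \<open>f : z \<boxtimes> x \<rightarrow> y\<close>.\<close>

definition curry_arrow :: "('u, 'o, 'm, 'z) ttcat_scheme \<Rightarrow> 'o \<Rightarrow> 'o \<Rightarrow> 'o \<Rightarrow> 'm \<Rightarrow> 'm" where
  "curry_arrow C z x y f =
     (THE h. h \<in> Hom C z (ihom C x y) \<and> cmp C (ev C x y) (tna C h (idm C x)) = f)"

text \<open>\<open>ihom a u : ihom a x \<rightarrow> ihom a y\<close> and \<open>ihom u a : ihom y a \<rightarrow> ihom x a\<close>, for \<open>u : x \<rightarrow> y\<close>.\<close>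

definition ihom_cov :: "('u, 'o, 'm, 'z) ttcat_scheme \<Rightarrow> 'o \<Rightarrow> 'm \<Rightarrow> 'm" where
  "ihom_cov C a u =
     curry_arrow C (ihom C a (src C u)) a (tgt C u) (cmp C u (ev C a (src C u)))"

definition ihom_con :: "('u, 'o, 'm, 'z) ttcat_scheme \<Rightarrow> 'm \<Rightarrow> 'o \<Rightarrow> 'm" where
  "ihom_con C u a =
     curry_arrow C (ihom C (tgt C u) a) (src C u) a
       (cmp C (ev C (tgt C u) a) (tna C (idm C (ihom C (tgt C u) a)) u))"

text \<open>\<open>x \<boxtimes> \<Sigma>y \<rightarrow> \<Sigma>(x \<boxtimes> y)\<close>, obtained from \<open>tsh\<close> by means of the symmetry.\<close>

definition tsh_right :: "('u, 'o, 'm, 'z) ttcat_scheme \<Rightarrow> 'o \<Rightarrow> 'o \<Rightarrow> 'm" where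
  "tsh_right C x y =
     cmp C (shm C (braid C y x)) (cmp C (tsh C y x) (braid C x (sh C y)))"

text \<open>
  The canonical arrows \<open>\<Sigma>(ihom a x) \<rightarrow> ihom a (\<Sigma>x)\<close> and \<open>\<Sigma>(ihom (\<Sigma>x) a) \<rightarrow> ihom x a\<close>,
  adjoint to the composites
  \<open>\<Sigma>(ihom a x) \<boxtimes> a \<rightarrow> \<Sigma>(ihom a x \<boxtimes> a) \<rightarrow> \<Sigma>x\<close> and
  \<open>\<Sigma>(ihom (\<Sigma>x) a) \<boxtimes> x \<rightarrow> \<Sigma>(ihom (\<Sigma>x) a \<boxtimes> x) \<rightarrow> ihom (\<Sigma>x) a \<boxtimes> \<Sigma>x \<rightarrow> a\<close>.
  Both are isomorphisms in the situation below.
\<close>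

definition ihom_sh_cov :: "('u, 'o, 'm, 'z) ttcat_scheme \<Rightarrow> 'o \<Rightarrow> 'o \<Rightarrow> 'm" where
  "ihom_sh_cov C a x =
     curry_arrow C (sh C (ihom C a x)) a (sh C x)
       (cmp C (shm C (ev C a x)) (tsh C (ihom C a x) a))"

definition ihom_sh_con :: "('u, 'o, 'm, 'z) ttcat_scheme \<Rightarrow> 'o \<Rightarrow> 'o \<Rightarrow> 'm" where
  "ihom_sh_con C x a =
     curry_arrow C (sh C (ihom C (sh C x) a)) x a
       (cmp C (ev C (sh C x) a)
         (cmp C (inv_arrow C (tsh_right C (ihom C (sh C x) a) x)) (tsh C (ihom C (sh C x) a) x)))"

text \<open>
  Compatibility of the closed symmetric monoidal structure with the triangulation in the sense of
  Hovey, Palmieri and Strickland (\<^emph>\<open>Axiomatic stable homotopy theory\<close>, Definition A.2.1):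
  the tensor product commutes coherently with suspension and is exact, the internal hom is exact in
  each variable, and the symmetry is graded commutative.  In \<open>ihom_con_exact\<close> the ``exactness up to
  sign'' of \<open>ihom - a\<close> appears after rotation, where the sign cancels: the triangle
  \<open>\<Sigma>\<^sup>-\<^sup>1 ihom x a \<rightarrow> ihom z a \<rightarrow> ihom y a \<rightarrow> ihom x a\<close> whose first arrow is \<open>- ihom w a\<close> has
  been rotated to end in \<open>\<Sigma>(ihom z a)\<close>.  Given \<open>tsh\<close>, the sign \<open>(-1)\<^bsup>rs\<^esup>\<close> for the symmetry on
  \<open>\<Sigma>\<^sup>r\<one> \<boxtimes> \<Sigma>\<^sup>s\<one>\<close> for all \<open>r, s\<close> amounts to the case \<open>r = s = 1\<close>.
\<close>

locale tt_category = triangulated_category C + closed_symmetric_monoidal C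
  for C :: "('u, 'o, 'm, 'z) ttcat_scheme" (structure) +
  assumes tna_addm_left: "\<lbrakk>f \<in> Hom C x x'; f' \<in> Hom C x x'; g \<in> Hom C y y'\<rbrakk>
          \<Longrightarrow> addm C f f' \<odot> g = addm C (f \<odot> g) (f' \<odot> g)"
    and tna_addm_right: "\<lbrakk>f \<in> Hom C x x'; g \<in> Hom C y y'; g' \<in> Hom C y y'\<rbrakk>
          \<Longrightarrow> f \<odot> addm C g g' = addm C (f \<odot> g) (f \<odot> g')"
    and tsh_iso: "\<lbrakk>x \<in> Ob C; y \<in> Ob C\<rbrakk>
          \<Longrightarrow> iso_arrow C (sh C x \<boxtimes> y) (sh C (x \<boxtimes> y)) (tsh C x y)"
    and tsh_natural: "\<lbrakk>f \<in> Hom C x x'; g \<in> Hom C y y'\<rbrakk>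
          \<Longrightarrow> tsh C x' y' \<cdot> (shm C f \<odot> g) = shm C (f \<odot> g) \<cdot> tsh C x y"
    and tsh_runit: "x \<in> Ob C \<Longrightarrow> shm C (runit C x) \<cdot> tsh C x (tunit C) = runit C (sh C x)"
    and tsh_assoc: "\<lbrakk>x \<in> Ob C; y \<in> Ob C; z \<in> Ob C\<rbrakk>
          \<Longrightarrow> shm C (assoc C x y z) \<cdot> tsh C (x \<boxtimes> y) z \<cdot> (tsh C x y \<odot> idm C z) =
              tsh C x (y \<boxtimes> z) \<cdot> assoc C (sh C x) y z"
    and tensor_exact: "\<lbrakk>exact_triangle C x y z u v w; a \<in> Ob C\<rbrakk>
          \<Longrightarrow> (u \<odot> idm C a, v \<odot> idm C a, tsh C x a \<cdot> (w \<odot> idm C a)) \<in> tri C"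
    and ihom_cov_exact: "\<lbrakk>exact_triangle C x y z u v w; a \<in> Ob C\<rbrakk>
          \<Longrightarrow> (ihom_cov C a u, ihom_cov C a v, inv_arrow C (ihom_sh_cov C a x) \<cdot> ihom_cov C a w) \<in> tri C"
    and ihom_con_exact: "\<lbrakk>exact_triangle C x y z u v w; a \<in> Ob C\<rbrakk>
          \<Longrightarrow> (ihom_con C v a, ihom_con C u a,
               shm C (ihom_con C w a) \<cdot> inv_arrow C (ihom_sh_con C x a)) \<in> tri C"
    and graded_symmetric: "braid C (sh C (tunit C)) (sh C (tunit C)) =
          negm C (idm C (sh C (tunit C) \<boxtimes> sh C (tunit C)))"


section \<open>Compact and dualizable objects\<close>

definition inaccessible :: "'u rel \<Rightarrow> bool" where
  "inaccessible \<kappa> \<longleftrightarrow> Card_order \<kappa> \<and> natLeq <o \<kappa> \<and> regularCard \<kappa> \<and>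
     (\<forall>A :: 'u set. |A| <o \<kappa> \<longrightarrow> |Pow A| <o \<kappa>)"

definition small :: "('u, 'o, 'm, 'z) cat_scheme \<Rightarrow> 'a set \<Rightarrow> bool" where
  "small C A \<longleftrightarrow> |A| <o univ C"

definition coproduct ::
  "('u, 'o, 'm, 'z) cat_scheme \<Rightarrow> 'u set \<Rightarrow> ('u \<Rightarrow> 'o) \<Rightarrow> 'o \<Rightarrow> ('u \<Rightarrow> 'm) \<Rightarrow> bool" where
  "coproduct C I t c \<iota> \<longleftrightarrow>
     c \<in> Ob C \<and> (\<forall>i\<in>I. t i \<in> Ob C \<and> \<iota> i \<in> Hom C (t i) c) \<and>
     (\<forall>y\<in>Ob C. \<forall>h. (\<forall>i\<in>I. h i \<in> Hom C (t i) y) \<longrightarrow>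
        (\<exists>!k. k \<in> Hom C c y \<and> (\<forall>i\<in>I. cmp C k (\<iota> i) = h i)))"

definition has_small_coproducts :: "('u, 'o, 'm, 'z) cat_scheme \<Rightarrow> bool" where
  "has_small_coproducts C \<longleftrightarrow>
     (\<forall>I t. small C I \<and> (\<forall>i\<in>I. t i \<in> Ob C) \<longrightarrow> (\<exists>c \<iota>. coproduct C I t c \<iota>))"

text \<open>\<open>x\<close> is compact if the canonical map \<open>\<Oplus>\<^sub>i Hom(x, t\<^sub>i) \<rightarrow> Hom(x, \<Oplus>\<^sub>i t\<^sub>i)\<close> is always bijective.\<close>

definition compact_objects :: "('u, 'o, 'm, 'z) cat_scheme \<Rightarrow> 'o set" where
  "compact_objects C = {x \<in> Ob C. \<forall>I t c \<iota>. small C I \<and> coproduct C I t c \<iota> \<longrightarrow>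
     (\<lambda>\<phi>. gfinprod (Hom_group C x c) (\<lambda>i. cmp C (\<iota> i) (\<phi> i)) I)
       \<in> iso (sum_group I (\<lambda>i. Hom_group C x (t i))) (Hom_group C x c)}"

definition dualizable_objects :: "('u, 'o, 'm, 'z) ttcat_scheme \<Rightarrow> 'o set" where
  "dualizable_objects C = {x \<in> Ob C. \<exists>d\<in>Ob C.
     \<exists>\<eta>\<in>Hom C (tunit C) (tno C x d). \<exists>\<epsilon>\<in>Hom C (tno C d x) (tunit C).
       cmp C (runit C x) (cmp C (tna C (idm C x) \<epsilon>)
         (cmp C (assoc C x d x) (tna C \<eta> (idm C x)))) = lunit C x \<and>
       cmp C (lunit C d) (cmp C (tna C \<epsilon> (idm C d))
         (cmp C (inv_arrow C (assoc C d x d)) (tna C (idm C d) \<eta>))) = runit C d}"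

text \<open>
  The generators are tested on \<open>Hom(g, \<Sigma>\<^sup>n t)\<close> for all integers \<open>n\<close>; negative \<open>n\<close> are expressed by
  the suspensions of \<open>g\<close>.
\<close>

definition compactly_generated :: "('u, 'o, 'm, 'z) tcat_scheme \<Rightarrow> bool" where
  "compactly_generated C \<longleftrightarrow>
     inaccessible (univ C) \<and> (\<forall>x\<in>Ob C. \<forall>y\<in>Ob C. small C (Hom C x y)) \<and>
     has_small_coproducts C \<and>
     (\<exists>G. G \<subseteq> compact_objects C \<and> small C G \<and>
        (\<forall>t\<in>Ob C. (\<forall>g\<in>G. \<forall>n. Hom C g ((sh C ^^ n) t) = {zerm C g ((sh C ^^ n) t)} \<and>
                              Hom C ((sh C ^^ n) g) t = {zerm C ((sh C ^^ n) g) t})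
           \<longrightarrow> zero_object C t))"

definition rigidly_compactly_generated :: "('u, 'o, 'm, 'z) ttcat_scheme \<Rightarrow> bool" where
  "rigidly_compactly_generated C \<longleftrightarrow>
     tt_category C \<and> compactly_generated C \<and> compact_objects C = dualizable_objects C"


section \<open>Subcategories and ideals\<close>

text \<open>Full replete subcategories are represented by their sets of objects.\<close>

definition triangulated_subcategory :: "('u, 'o, 'm, 'z) tcat_scheme \<Rightarrow> 'o set \<Rightarrow> bool" where
  "triangulated_subcategory C S \<longleftrightarrow>
     S \<subseteq> Ob C \<and> (\<exists>z\<in>S. zero_object C z) \<and>
     (\<forall>x\<in>S. \<forall>y. isomorphic C x y \<longrightarrow> y \<in> S) \<and>
     (\<forall>x\<in>Ob C. sh C x \<in> S \<longleftrightarrow> x \<in> S) \<and>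
     (\<forall>x y z u v w. exact_triangle C x y z u v w \<and> x \<in> S \<and> y \<in> S \<longrightarrow> z \<in> S)"

definition localizing :: "('u, 'o, 'm, 'z) tcat_scheme \<Rightarrow> 'o set \<Rightarrow> bool" where
  "localizing C L \<longleftrightarrow> triangulated_subcategory C L \<and>
     (\<forall>I t c \<iota>. small C I \<and> (\<forall>i\<in>I. t i \<in> L) \<and> coproduct C I t c \<iota> \<longrightarrow> c \<in> L)"

definition localizing_ideal :: "('u, 'o, 'm, 'z) ttcat_scheme \<Rightarrow> 'o set \<Rightarrow> bool" where
  "localizing_ideal C L \<longleftrightarrow> localizing C L \<and> (\<forall>s\<in>Ob C. \<forall>t\<in>L. tno C s t \<in> L)"

definition Loc :: "('u, 'o, 'm, 'z) tcat_scheme \<Rightarrow> 'o set \<Rightarrow> 'o set" where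
  "Loc C E = \<Inter>{L. localizing C L \<and> E \<subseteq> L}"

definition Loc_ideal :: "('u, 'o, 'm, 'z) ttcat_scheme \<Rightarrow> 'o set \<Rightarrow> 'o set" where
  "Loc_ideal C E = \<Inter>{L. localizing_ideal C L \<and> E \<subseteq> L}"

definition minimal_localizing_ideal :: "('u, 'o, 'm, 'z) ttcat_scheme \<Rightarrow> 'o set \<Rightarrow> bool" where
  "minimal_localizing_ideal C L \<longleftrightarrow>
     localizing_ideal C L \<and> L \<noteq> {z. zero_object C z} \<and>
     (\<forall>L'. localizing_ideal C L' \<and> L' \<subseteq> L \<longrightarrow> L' = {z. zero_object C z} \<or> L' = L)"


section \<open>The Balmer spectrum\<close>

definition thick_ideal :: "('u, 'o, 'm, 'z) ttcat_scheme \<Rightarrow> 'o set \<Rightarrow> bool" where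
  "thick_ideal C J \<longleftrightarrow>
     J \<subseteq> compact_objects C \<and> triangulated_subcategory C J \<and>
     (\<forall>x y s i j p q. biproduct C x y s i j p q \<and> s \<in> J \<longrightarrow> x \<in> J \<and> y \<in> J) \<and>
     (\<forall>x\<in>compact_objects C. \<forall>y\<in>J. tno C x y \<in> J)"

definition Spc :: "('u, 'o, 'm, 'z) ttcat_scheme \<Rightarrow> 'o set set" where
  "Spc C = {P. thick_ideal C P \<and> P \<noteq> compact_objects C \<and>
     (\<forall>x\<in>compact_objects C. \<forall>y\<in>compact_objects C. tno C x y \<in> P \<longrightarrow> x \<in> P \<or> y \<in> P)}"

definition supp :: "('u, 'o, 'm, 'z) ttcat_scheme \<Rightarrow> 'o \<Rightarrow> 'o set set" where
  "supp C x = {P \<in> Spc C. x \<notin> P}"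

text \<open>
  Since \<open>supp(x) \<union> supp(y) = supp(x \<oplus> y)\<close> and \<open>supp(0)\<close> is empty, the generating family below is a
  basis of open sets and the space is \<open>Spc C\<close>.
\<close>

definition Spc_topology :: "('u, 'o, 'm, 'z) ttcat_scheme \<Rightarrow> 'o set topology" where
  "Spc_topology C = topology_generated_by {Spc C - supp C x |x. x \<in> compact_objects C}"

definition Thomason :: "'a topology \<Rightarrow> 'a set \<Rightarrow> bool" where
  "Thomason X Y \<longleftrightarrow>
     (\<exists>\<F>. (\<forall>Z\<in>\<F>. closedin X Z \<and> compactin X (topspace X - Z)) \<and> Y = \<Union>\<F>)"

definition weakly_noetherian :: "'a topology \<Rightarrow> bool" where
  "weakly_noetherian X \<longleftrightarrow>
     (\<forall>P\<in>topspace X. \<exists>Y1 Y2. Thomason X Y1 \<and> Thomason X Y2 \<and> {P} = Y1 \<inter> (topspace X - Y2))"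


section \<open>Idempotent triangles, support and stratification\<close>

definition compact_supported_on :: "('u, 'o, 'm, 'z) ttcat_scheme \<Rightarrow> 'o set set \<Rightarrow> 'o set" where
  "compact_supported_on C Y = {x \<in> compact_objects C. supp C x \<subseteq> Y}"

definition idempotent_triangle ::
  "('u, 'o, 'm, 'z) ttcat_scheme \<Rightarrow> 'o set set \<Rightarrow> 'o \<Rightarrow> 'o \<Rightarrow> bool" where
  "idempotent_triangle C Y e f \<longleftrightarrow>
     (\<exists>u v w. exact_triangle C e (tunit C) f u v w) \<and>
     zero_object C (tno C e f) \<and>
     Loc_ideal C {e} = {t \<in> Ob C. zero_object C (tno C f t)} \<and>
     Loc_ideal C {e} = Loc C (compact_supported_on C Y)"

text \<open>
  \<open>g(P)\<close> is determined up to isomorphism only; an arbitrary representative is chosen.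
\<close>

definition point_idempotent :: "('u, 'o, 'm, 'z) ttcat_scheme \<Rightarrow> 'o set \<Rightarrow> 'o" where
  "point_idempotent C P = (SOME g. \<exists>Y1 Y2 e1 f1 e2 f2.
     Thomason (Spc_topology C) Y1 \<and> Thomason (Spc_topology C) Y2 \<and> {P} = Y1 \<inter> (Spc C - Y2) \<and>
     idempotent_triangle C Y1 e1 f1 \<and> idempotent_triangle C Y2 e2 f2 \<and> g = tno C e1 f2)"

definition Supp :: "('u, 'o, 'm, 'z) ttcat_scheme \<Rightarrow> 'o \<Rightarrow> 'o set set" where
  "Supp C t = {P \<in> Spc C. \<not> zero_object C (tno C (point_idempotent C P) t)}"

definition stratified :: "('u, 'o, 'm, 'z) ttcat_scheme \<Rightarrow> bool" where
  "stratified C \<longleftrightarrow>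
     (\<forall>t\<in>Ob C. Loc_ideal C {t} = Loc_ideal C {tno C t (point_idempotent C P) |P. P \<in> Spc C}) \<and>
     (\<forall>P\<in>Spc C. minimal_localizing_ideal C (Loc_ideal C {point_idempotent C P}))"

end

theory Submission
  imports Defs
begin

text \<open>
  The objects annihilated by \<open>t\<^sub>2\<close> form a localizing ideal \<open>L\<close>; closure under coproducts holds because
  \<open>- \<otimes> t\<^sub>2\<close> has a right adjoint.  If \<open>g(P) \<otimes> t\<^sub>1\<close> is nonzero and annihilated by \<open>t\<^sub>2\<close>, it lies in
  both \<open>L\<close> and the minimal ideal generated by \<open>g(P)\<close>; minimality puts that ideal, and hence \<open>g(P)\<close>,
  inside \<open>L\<close>.
\<close>

section \<open>Isomorphisms, zero objects and coproducts in a category\<close>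

context category
begin

lemma Hom_Ob:
  assumes "f \<in> Hom C x y"
  shows "x \<in> Ob C" "y \<in> Ob C"
  using assms src_Ob tgt_Ob unfolding Hom_def by auto

lemma iso_arrow_inverse:
  assumes "iso_arrow C x y f"
  obtains g where "f \<in> Hom C x y" "g \<in> Hom C y x" "g \<cdot> f = idm C x" "f \<cdot> g = idm C y"
  using assms unfolding iso_arrow_def inverse_arrows_def Hom_def by auto

lemma isomorphicI:
  assumes "f \<in> Hom C x y" "g \<in> Hom C y x" "g \<cdot> f = idm C x" "f \<cdot> g = idm C y"
  shows "isomorphic C x y"
  using assms unfolding isomorphic_def iso_arrow_def inverse_arrows_def Hom_def by auto

lemma isomorphic_sym: "isomorphic C x y \<Longrightarrow> isomorphic C y x"
  unfolding isomorphic_def[of C x y] by (metis iso_arrow_inverse isomorphicI)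

lemma zero_object_Hom_eq:
  assumes "zero_object C z"
  shows "\<lbrakk>f \<in> Hom C z x; g \<in> Hom C z x\<rbrakk> \<Longrightarrow> f = g"
    and "\<lbrakk>f \<in> Hom C x z; g \<in> Hom C x z\<rbrakk> \<Longrightarrow> f = g"
  using assms Hom_Ob unfolding zero_object_def by metis+

lemma zero_objects_isomorphic:
  assumes "zero_object C z" "zero_object C z'"
  shows "isomorphic C z z'"
proof -
  have ob: "z \<in> Ob C" "z' \<in> Ob C"
    using assms unfolding zero_object_def by auto
  obtain f g where fg: "f \<in> Hom C z z'" "g \<in> Hom C z' z"
    using assms ob unfolding zero_object_def by metis
  show ?thesis
    by (rule isomorphicI[OF fg])
      (use assms ob fg in \<open>auto intro: zero_object_Hom_eq cmp_Hom idm_Hom\<close>)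
qed

text \<open>The uniqueness half of the universal property, applied to the family
  \<open>k \<cdot> \<iota> i\<close>: both \<open>k\<close> and \<open>k'\<close> are arrows
  inducing it. Thus the coproduct inclusions are jointly epic.\<close>

lemma coproduct_Hom_eq:
  assumes cop: "coproduct C I t c \<iota>" and k: "k \<in> Hom C c y" and k': "k' \<in> Hom C c y"
    and eq: "\<And>i. i \<in> I \<Longrightarrow> k' \<cdot> \<iota> i = k \<cdot> \<iota> i"
  shows "k = k'"
proof -
  have \<iota>: "\<And>i. i \<in> I \<Longrightarrow> \<iota> i \<in> Hom C (t i) c"
    and univ: "\<forall>y\<in>Ob C. \<forall>h. (\<forall>i\<in>I. h i \<in> Hom C (t i) y) \<longrightarrow>
      (\<exists>!k. k \<in> Hom C c y \<and> (\<forall>i\<in>I. k \<cdot> \<iota> i = h i))"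
    using cop unfolding coproduct_def by simp_all
  have "\<forall>i\<in>I. k \<cdot> \<iota> i \<in> Hom C (t i) y"
    using cmp_Hom[OF \<iota> k] by simp
  then have U: "\<exists>!k'. k' \<in> Hom C c y \<and> (\<forall>i\<in>I. k' \<cdot> \<iota> i = k \<cdot> \<iota> i)"
    by (rule univ[THEN bspec, OF Hom_Ob(2)[OF k], THEN spec, THEN mp])
  have "k \<in> Hom C c y \<and> (\<forall>i\<in>I. k \<cdot> \<iota> i = k \<cdot> \<iota> i)" "k' \<in> Hom C c y \<and> (\<forall>i\<in>I. k' \<cdot> \<iota> i = k \<cdot> \<iota> i)"
    using k k' eq by simp_all
  from this[THEN the1_equality[OF U]] show ?thesis
    by (rule trans[OF sym])
qed

end

section \<open>Zero arrows and zero objects in an additive category\<close>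

context additive_category
begin

lemma zerm_Hom:
  assumes "x \<in> Ob C" "y \<in> Ob C"
  shows "zerm C x y \<in> Hom C x y"
proof -
  interpret comm_group "Hom_group C x y" using Hom_comm_group[OF assms] .
  show ?thesis using one_closed by (simp add: Hom_group_def)
qed

text \<open>Cancellation in the Hom group. This is the device for showing that composition,
  suspension and tensor product preserve zero arrows: each is additive, so it sends
  \<open>zerm\<close>, which equals its own double, to an arrow with the same property.\<close>

lemma addm_idem_imp_zerm:
  assumes "f \<in> Hom C x y" "addm C f f = f"
  shows "f = zerm C x y"
proof -
  interpret comm_group "Hom_group C x y" using Hom_comm_group Hom_Ob assms(1) by blast
  show ?thesis using assms r_cancel_one'[of f f] by (simp add: Hom_group_def)
qed

lemma addm_zerm_zerm:
  assumes "x \<in> Ob C" "y \<in> Ob C"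
  shows "addm C (zerm C x y) (zerm C x y) = zerm C x y"
proof -
  interpret comm_group "Hom_group C x y" using Hom_comm_group[OF assms] .
  show ?thesis using l_one[OF one_closed] by (simp add: Hom_group_def)
qed

lemma zerm_cmp:
  assumes f: "f \<in> Hom C x y" and z: "z \<in> Ob C"
  shows "zerm C y z \<cdot> f = zerm C x z"
proof (rule addm_idem_imp_zerm)
  note e = zerm_Hom[OF Hom_Ob(2)[OF f] z]
  show "zerm C y z \<cdot> f \<in> Hom C x z"
    using cmp_Hom[OF f e] .
  show "addm C (zerm C y z \<cdot> f) (zerm C y z \<cdot> f) = zerm C y z \<cdot> f"
    using cmp_addm_left[OF f e e] addm_zerm_zerm Hom_Ob[OF e] by simp
qed

lemma cmp_zerm:
  assumes f: "f \<in> Hom C x y" and z: "z \<in> Ob C"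
  shows "f \<cdot> zerm C z x = zerm C z y"
proof (rule addm_idem_imp_zerm)
  note e = zerm_Hom[OF z Hom_Ob(1)[OF f]]
  show "f \<cdot> zerm C z x \<in> Hom C z y"
    using cmp_Hom[OF e f] .
  show "addm C (f \<cdot> zerm C z x) (f \<cdot> zerm C z x) = f \<cdot> zerm C z x"
    using cmp_addm_right[OF e e f] addm_zerm_zerm Hom_Ob[OF e] by simp
qed

text \<open>Every arrow into or out of \<open>x\<close> factors through the identity of
  \<open>x\<close>, so it vanishes once that identity does. The equational form is convenient
  because additive functors preserve both identities and zero arrows.\<close>

lemma zero_object_iff: "zero_object C x \<longleftrightarrow> x \<in> Ob C \<and> idm C x = zerm C x x"
proof (intro iffI conjI)
  assume zero: "zero_object C x"
  then show x: "x \<in> Ob C"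
    unfolding zero_object_def by blast
  show "idm C x = zerm C x x"
    using zero_object_Hom_eq(1)[OF zero idm_Hom zerm_Hom] x by blast
next
  assume x: "x \<in> Ob C \<and> idm C x = zerm C x x"
  show "zero_object C x"
    unfolding zero_object_def
  proof (intro conjI ballI)
    fix y assume y: "y \<in> Ob C"
    have "f = zerm C y x" if "f \<in> Hom C y x" for f
      using that x idm_cmp zerm_cmp by metis
    then show "\<exists>!f. f \<in> Hom C y x"
      using zerm_Hom x y by blast
    have "f = zerm C x y" if "f \<in> Hom C x y" for f
      using that x cmp_idm cmp_zerm by metis
    then show "\<exists>!f. f \<in> Hom C x y"
      using zerm_Hom x y by blast
  qed (use x in blast)
qed

text \<open>The arrow \<open>f\<close> ends in a zero object and is therefore zero, so the identity
  \<open>g \<cdot> f\<close> of \<open>y\<close> is zero as well.\<close>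

lemma zero_object_retract:
  assumes "zero_object C x" "f \<in> Hom C y x" "g \<in> Hom C x y" "g \<cdot> f = idm C y"
  shows "zero_object C y"
proof -
  have y: "y \<in> Ob C" and x: "x \<in> Ob C"
    using Hom_Ob assms(2) by auto
  have "f = zerm C y x"
    using zero_object_Hom_eq(2) assms(1,2) zerm_Hom x y by blast
  then show ?thesis
    using assms(3,4) cmp_zerm y by (simp add: zero_object_iff)
qed

lemma zero_object_isomorphic:
  assumes "isomorphic C x y"
  shows "zero_object C x \<longleftrightarrow> zero_object C y"
proof -
  obtain f where "iso_arrow C x y f"
    using assms unfolding isomorphic_def by blast
  then obtain g where "f \<in> Hom C x y" "g \<in> Hom C y x" "g \<cdot> f = idm C x" "f \<cdot> g = idm C y"
    by (rule iso_arrow_inverse)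
  then show ?thesis
    using zero_object_retract by blast
qed

lemma negm_Hom:
  assumes "f \<in> Hom C x y"
  shows "negm C f \<in> Hom C x y"
proof -
  interpret comm_group "Hom_group C x y" using Hom_comm_group Hom_Ob assms by blast
  show ?thesis using assms inv_closed[of f] by (simp add: Hom_group_def negm_def Hom_def)
qed

text \<open>Removes the signs that rotation of triangles introduces when an arrow is tested for
  being zero.\<close>

lemma negm_eq_zerm:
  assumes "f \<in> Hom C x y" "negm C f = zerm C x y"
  shows "f = zerm C x y"
proof -
  interpret comm_group "Hom_group C x y" using Hom_comm_group Hom_Ob assms(1) by blast
  show ?thesis
    using assms inv_eq_1_iff[of f] by (simp add: Hom_group_def negm_def Hom_def)
qed

end

section \<open>Zero objects under suspension and in exact triangles\<close>

context triangulated_category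
begin

lemma shm_Hom: "f \<in> Hom C x y \<Longrightarrow> shm C f \<in> Hom C (sh C x) (sh C y)"
  using shm_bij Hom_Ob unfolding bij_betw_def by blast

lemma shm_zerm:
  assumes "x \<in> Ob C" "y \<in> Ob C"
  shows "shm C (zerm C x y) = zerm C (sh C x) (sh C y)"
  by (rule addm_idem_imp_zerm)
    (use assms shm_Hom zerm_Hom shm_addm addm_zerm_zerm in metis)+

text \<open>Suspension is injective on endomorphisms of \<open>x\<close> and preserves the identity
  and the zero arrow, so it neither creates nor destroys their equality.\<close>

lemma zero_object_sh:
  assumes x: "x \<in> Ob C"
  shows "zero_object C (sh C x) \<longleftrightarrow> zero_object C x"
proof -
  have "inj_on (shm C) (Hom C x x)"
    using shm_bij[OF x x] by (rule bij_betw_imp_inj_on)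
  then have "shm C (idm C x) = shm C (zerm C x x) \<longleftrightarrow> idm C x = zerm C x x"
    using idm_Hom[OF x] zerm_Hom[OF x x] by (rule inj_on_eq_iff)
  then show ?thesis
    using x sh_Ob shm_idm shm_zerm by (simp add: zero_object_iff)
qed

text \<open>
  Mapping the triangle on \<open>id\<^sub>z\<close> to the given one, both rotated so that \<open>z\<close> comes first, factors
  \<open>- id\<close> of \<open>\<Sigma>z\<close> through \<open>\<Sigma>y\<close>.
\<close>

lemma exact_triangle_zero_object:
  assumes tri: "exact_triangle C x y z u v w" and zx: "zero_object C x" and zy: "zero_object C y"
  shows "zero_object C z"
proof -
  have u: "u \<in> Hom C x y" and v: "v \<in> Hom C y z" and w: "w \<in> Hom C z (sh C x)"
    and T: "(u, v, w) \<in> tri C"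
    using tri unfolding exact_triangle_def by auto
  have ob: "x \<in> Ob C" "y \<in> Ob C" "z \<in> Ob C"
    using Hom_Ob u v by auto
  have zsx: "zero_object C (sh C x)" and zsy: "zero_object C (sh C y)"
    using zero_object_sh zx zy ob by auto
  obtain q where zq: "zero_object C q"
    using ex_zero_object by blast
  then have q: "q \<in> Ob C"
    unfolding zero_object_def by blast
  note sob = sh_Ob[OF ob(1)] sh_Ob[OF ob(2)] sh_Ob[OF ob(3)]
  note su = negm_Hom[OF shm_Hom[OF u]] and sv = negm_Hom[OF shm_Hom[OF v]]
  note si = negm_Hom[OF shm_Hom[OF idm_Hom[OF ob(3)]]]
  have "(v, w, negm C (shm C u)) \<in> tri C"
    using tri_rotate[OF u v w] T by blast
  then have "(w, negm C (shm C u), negm C (shm C v)) \<in> tri C"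
    using tri_rotate[OF v w su] by blast
  then have tri2: "exact_triangle C z (sh C x) (sh C y) w (negm C (shm C u)) (negm C (shm C v))"
    unfolding exact_triangle_def using w su sv by blast
  note zq1 = zerm_Hom[OF ob(3) q] and zq2 = zerm_Hom[OF q sob(3)]
  have "(zerm C z q, zerm C q (sh C z), negm C (shm C (idm C z))) \<in> tri C"
    using tri_rotate[OF idm_Hom[OF ob(3)] zq1 zq2] tri_idm[OF ob(3) zq] by blast
  then have tri1: "exact_triangle C z q (sh C z) (zerm C z q) (zerm C q (sh C z))
      (negm C (shm C (idm C z)))"
    unfolding exact_triangle_def using zq1 zq2 si by blast
  note b = zerm_Hom[OF q sob(1)]
  \<comment> \<open>The vanishing of \<open>x\<close> makes this square commute, as both composites
    end in the zero object \<open>sh C x\<close>. The vanishing of \<open>y\<close> is used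
    afterwards, to kill the filler \<open>c\<close>.\<close>
  have "w \<cdot> idm C z = zerm C q (sh C x) \<cdot> zerm C z q"
    using zero_object_Hom_eq(2)[OF zsx cmp_Hom[OF idm_Hom[OF ob(3)] w] cmp_Hom[OF zq1 b]] .
  then obtain c where c: "c \<in> Hom C (sh C z) (sh C y)"
    and eq: "negm C (shm C v) \<cdot> c = shm C (idm C z) \<cdot> negm C (shm C (idm C z))"
    using tri_morphism[OF tri1 tri2 idm_Hom[OF ob(3)] b] by blast
  have "c = zerm C (sh C z) (sh C y)"
    using zero_object_Hom_eq(2)[OF zsy c zerm_Hom[OF sob(3,2)]] .
  then have "negm C (shm C (idm C z)) = zerm C (sh C z) (sh C z)"
    using eq cmp_zerm[OF sv sob(3)] idm_cmp[OF si] shm_idm[OF ob(3)] by simp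
  then have "shm C (idm C z) = zerm C (sh C z) (sh C z)"
    using negm_eq_zerm shm_Hom[OF idm_Hom[OF ob(3)]] by blast
  then have "zero_object C (sh C z)"
    using shm_idm[OF ob(3)] sob(3) by (simp add: zero_object_iff)
  then show ?thesis
    using zero_object_sh ob(3) by blast
qed

end

section \<open>Subcategories, ideals and arrows into the internal hom\<close>

lemma triangulated_subcategoryD:
  assumes "triangulated_subcategory C S"
  shows "S \<subseteq> Ob C" "\<exists>z\<in>S. zero_object C z"
    "\<lbrakk>x \<in> S; isomorphic C x y\<rbrakk> \<Longrightarrow> y \<in> S"
    "x \<in> Ob C \<Longrightarrow> sh C x \<in> S \<longleftrightarrow> x \<in> S"
    "\<lbrakk>exact_triangle C x y z u v w; x \<in> S; y \<in> S\<rbrakk> \<Longrightarrow> z \<in> S"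
  using assms unfolding triangulated_subcategory_def by blast+

lemma localizing_idealD:
  assumes "localizing_ideal C L"
  shows "triangulated_subcategory C L" "L \<subseteq> Ob C"
    "\<lbrakk>small C I; \<And>i. i \<in> I \<Longrightarrow> t i \<in> L; coproduct C I t c \<iota>\<rbrakk> \<Longrightarrow> c \<in> L"
    "\<lbrakk>s \<in> Ob C; t' \<in> L\<rbrakk> \<Longrightarrow> tno C s t' \<in> L"
  using assms unfolding localizing_ideal_def localizing_def triangulated_subcategory_def by blast+

context triangulated_category
begin

text \<open>The definition supplies only some zero object; repleteness yields all of them, since
  zero objects are isomorphic. This guarantees that two such subcategories have a zero object in
  common.\<close>

lemma triangulated_subcategory_zero_object:
  assumes "triangulated_subcategory C S" "zero_object C z"
  shows "z \<in> S"
  using assms triangulated_subcategoryD zero_objects_isomorphic by meson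

lemma triangulated_subcategory_Int:
  assumes S: "triangulated_subcategory C S" and S': "triangulated_subcategory C S'"
  shows "triangulated_subcategory C (S \<inter> S')"
  unfolding triangulated_subcategory_def
proof (intro conjI)
  obtain z where "z \<in> S" "zero_object C z"
    using triangulated_subcategoryD(2)[OF S] by blast
  then show "\<exists>z\<in>S \<inter> S'. zero_object C z"
    using triangulated_subcategory_zero_object[OF S'] by blast
next
  show "S \<inter> S' \<subseteq> Ob C"
    using triangulated_subcategoryD(1)[OF S] by blast
  show "\<forall>x\<in>S \<inter> S'. \<forall>y. isomorphic C x y \<longrightarrow> y \<in> S \<inter> S'"
    using triangulated_subcategoryD(3)[OF S] triangulated_subcategoryD(3)[OF S'] by blast
  show "\<forall>x\<in>Ob C. (sh C x \<in> S \<inter> S') = (x \<in> S \<inter> S')"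
    using triangulated_subcategoryD(4)[OF S] triangulated_subcategoryD(4)[OF S'] by simp
  show "\<forall>x y z u v w. exact_triangle C x y z u v w \<and> x \<in> S \<inter> S' \<and> y \<in> S \<inter> S' \<longrightarrow> z \<in> S \<inter> S'"
    using triangulated_subcategoryD(5)[OF S] triangulated_subcategoryD(5)[OF S'] by blast
qed

end

text \<open>The uniqueness half of the tensor-hom adjunction: currying is well defined, so arrows
  into the internal hom may be compared after evaluation.\<close>

lemma (in closed_symmetric_monoidal) ihom_Hom_eq:
  assumes x: "x \<in> Ob C" and y: "y \<in> Ob C"
    and k: "k \<in> Hom C z (ihom C x y)" and k': "k' \<in> Hom C z (ihom C x y)"
    and eq: "ev C x y \<cdot> (k' \<odot> idm C x) = ev C x y \<cdot> (k \<odot> idm C x)"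
  shows "k = k'"
proof -
  have "ev C x y \<cdot> (k \<odot> idm C x) \<in> Hom C (z \<boxtimes> x) y"
    using cmp_Hom[OF tna_Hom[OF k idm_Hom[OF x]] ev_Hom[OF x y]] .
  note U = ihom_universal[OF x y Hom_Ob(1)[OF k] this]
  show ?thesis
    using the1_equality[OF U conjI[OF k refl]] the1_equality[OF U conjI[OF k' eq]]
    by (rule trans[OF sym])
qed

context tt_category
begin

text \<open>Minimality of an ideal tests only ideals contained in it; intersecting brings an
  arbitrary ideal inside.\<close>

lemma localizing_ideal_Int:
  assumes L: "localizing_ideal C L" and L': "localizing_ideal C L'"
  shows "localizing_ideal C (L \<inter> L')"
  unfolding localizing_ideal_def localizing_def
proof (intro conjI)
  show "triangulated_subcategory C (L \<inter> L')"
    using triangulated_subcategory_Int localizing_idealD(1) L L' by blast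
  show "\<forall>I t c \<iota>. small C I \<and> (\<forall>i\<in>I. t i \<in> L \<inter> L') \<and> coproduct C I t c \<iota> \<longrightarrow> c \<in> L \<inter> L'"
  proof (intro allI impI IntI)
    fix I t c \<iota>
    assume *: "small C I \<and> (\<forall>i\<in>I. t i \<in> L \<inter> L') \<and> coproduct C I t c \<iota>"
    show "c \<in> L" by (rule localizing_idealD(3)[OF L, of I t c \<iota>]) (use * in auto)
    show "c \<in> L'" by (rule localizing_idealD(3)[OF L', of I t c \<iota>]) (use * in auto)
  qed
  show "\<forall>s\<in>Ob C. \<forall>t\<in>L \<inter> L'. s \<boxtimes> t \<in> L \<inter> L'"
    using localizing_idealD(4)[OF L] localizing_idealD(4)[OF L'] by simp
qed

section \<open>Zero arrows, isomorphisms and zero objects under the tensor product\<close>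

lemma zerm_tna:
  assumes x: "x \<in> Ob C" "x' \<in> Ob C" and g: "g \<in> Hom C y y'"
  shows "zerm C x x' \<odot> g = zerm C (x \<boxtimes> y) (x' \<boxtimes> y')"
proof (rule addm_idem_imp_zerm)
  note e = zerm_Hom[OF x]
  show "zerm C x x' \<odot> g \<in> Hom C (x \<boxtimes> y) (x' \<boxtimes> y')"
    using tna_Hom[OF e g] .
  show "addm C (zerm C x x' \<odot> g) (zerm C x x' \<odot> g) = zerm C x x' \<odot> g"
    using tna_addm_left[OF e e g] addm_zerm_zerm[OF x] by simp
qed

lemma isomorphic_tno_left:
  assumes "isomorphic C x y" "a \<in> Ob C"
  shows "isomorphic C (x \<boxtimes> a) (y \<boxtimes> a)"
proof -
  obtain f where "iso_arrow C x y f"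
    using assms(1) unfolding isomorphic_def by blast
  then obtain g where fg: "f \<in> Hom C x y" "g \<in> Hom C y x" "g \<cdot> f = idm C x" "f \<cdot> g = idm C y"
    by (rule iso_arrow_inverse)
  note a = idm_Hom[OF assms(2)]
  show ?thesis
    by (rule isomorphicI[OF tna_Hom[OF fg(1) a] tna_Hom[OF fg(2) a]])
      (use tna_cmp[OF fg(1,2) a a] tna_cmp[OF fg(2,1) a a] cmp_idm[OF a] fg Hom_Ob[OF fg(1)]
        tna_idm assms(2) in simp_all)
qed

lemma isomorphic_braid: "\<lbrakk>x \<in> Ob C; y \<in> Ob C\<rbrakk> \<Longrightarrow> isomorphic C (x \<boxtimes> y) (y \<boxtimes> x)"
  using braid_iso unfolding isomorphic_def by blast

lemma isomorphic_assoc: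
  "\<lbrakk>x \<in> Ob C; y \<in> Ob C; z \<in> Ob C\<rbrakk> \<Longrightarrow> isomorphic C ((x \<boxtimes> y) \<boxtimes> z) (x \<boxtimes> (y \<boxtimes> z))"
  using assoc_iso unfolding isomorphic_def by blast

lemma isomorphic_tsh:
  "\<lbrakk>x \<in> Ob C; y \<in> Ob C\<rbrakk> \<Longrightarrow> isomorphic C (sh C x \<boxtimes> y) (sh C (x \<boxtimes> y))"
  using tsh_iso unfolding isomorphic_def by blast

text \<open>The identity of \<open>x \<boxtimes> y\<close> is
  \<open>idm C x \<odot> idm C y\<close>, whose left factor is a zero arrow.\<close>

lemma zero_object_tno_left:
  assumes "zero_object C x" "y \<in> Ob C"
  shows "zero_object C (x \<boxtimes> y)"
  using assms tna_idm[of x y] zerm_tna[OF _ _ idm_Hom[of y], of x x] tno_Ob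
  by (simp add: zero_object_iff)

lemma zero_object_tno_right:
  assumes "x \<in> Ob C" "zero_object C y"
  shows "zero_object C (x \<boxtimes> y)"
proof -
  have "y \<in> Ob C"
    using assms(2) by (simp add: zero_object_iff)
  then show ?thesis
    using zero_object_isomorphic[OF isomorphic_braid] zero_object_tno_left[OF assms(2,1)] assms(1)
    by simp
qed

section \<open>Triangles and coproducts under the tensor product\<close>

lemma exact_triangle_tensor:
  assumes tri: "exact_triangle C x y z u v w" and a: "a \<in> Ob C"
  shows "exact_triangle C (x \<boxtimes> a) (y \<boxtimes> a) (z \<boxtimes> a)
    (u \<odot> idm C a) (v \<odot> idm C a) (tsh C x a \<cdot> (w \<odot> idm C a))"
proof -
  have u: "u \<in> Hom C x y" and v: "v \<in> Hom C y z" and w: "w \<in> Hom C z (sh C x)"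
    using tri unfolding exact_triangle_def by auto
  \<comment> \<open>The axiom \<open>tensor_exact\<close> gives membership in \<open>tri C\<close>;
    the typing of the arrows is added here. The comparison \<open>tsh\<close> makes the third arrow
    end in the suspension of \<open>x \<boxtimes> a\<close>.\<close>
  have "tsh C x a \<in> Hom C (sh C x \<boxtimes> a) (sh C (x \<boxtimes> a))"
    using tsh_iso[OF Hom_Ob(1)[OF u] a] unfolding iso_arrow_def by blast
  then show ?thesis
    unfolding exact_triangle_def
    using tensor_exact[OF tri a] tna_Hom[OF u] tna_Hom[OF v] tna_Hom[OF w] idm_Hom[OF a] cmp_Hom
    by blast
qed

text \<open>By adjunction, arrows from \<open>c \<boxtimes> a\<close> to \<open>y\<close> are arrows
  from the coproduct \<open>c\<close> to \<open>ihom C a y\<close>, and these are determined by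
  their restrictions to the summands. Hence the arrows \<open>\<iota> i \<odot> idm C a\<close> are
  jointly epic.\<close>

lemma coproduct_tensor_Hom_eq:
  assumes cop: "coproduct C I t c \<iota>" and a: "a \<in> Ob C"
    and f: "f \<in> Hom C (c \<boxtimes> a) y" and f': "f' \<in> Hom C (c \<boxtimes> a) y"
    and eq: "\<And>i. i \<in> I \<Longrightarrow> f \<cdot> (\<iota> i \<odot> idm C a) = f' \<cdot> (\<iota> i \<odot> idm C a)"
  shows "f = f'"
proof -
  have c: "c \<in> Ob C" and \<iota>: "\<And>i. i \<in> I \<Longrightarrow> \<iota> i \<in> Hom C (t i) c"
    using cop unfolding coproduct_def by auto
  have y: "y \<in> Ob C"
    using Hom_Ob f by blast
  note a1 = idm_Hom[OF a] and e = ev_Hom[OF a y]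
  obtain h where h: "h \<in> Hom C c (ihom C a y)" "ev C a y \<cdot> (h \<odot> idm C a) = f"
    using ihom_universal[OF a y c f] by blast
  obtain h' where h': "h' \<in> Hom C c (ihom C a y)" "ev C a y \<cdot> (h' \<odot> idm C a) = f'"
    using ihom_universal[OF a y c f'] by blast
  \<comment> \<open>Naturality of the adjunction: restricting to a summand commutes with
    uncurrying.\<close>
  have uncurry: "ev C a y \<cdot> ((k \<cdot> \<iota> i) \<odot> idm C a) = (ev C a y \<cdot> (k \<odot> idm C a)) \<cdot> (\<iota> i \<odot> idm C a)"
    if "i \<in> I" "k \<in> Hom C c (ihom C a y)" for i k
    using tna_cmp[OF \<iota>[OF that(1)] that(2) a1 a1] cmp_idm[OF a1]
      cmp_assoc[OF tna_Hom[OF \<iota>[OF that(1)] a1] tna_Hom[OF that(2) a1] e] by simp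
  have "h = h'"
  proof (rule coproduct_Hom_eq[OF cop h(1) h'(1)])
    fix i assume i: "i \<in> I"
    have "ev C a y \<cdot> ((h \<cdot> \<iota> i) \<odot> idm C a) = ev C a y \<cdot> ((h' \<cdot> \<iota> i) \<odot> idm C a)"
      using uncurry[OF i h(1)] uncurry[OF i h'(1)] h(2) h'(2) eq[OF i] by simp
    then show "h' \<cdot> \<iota> i = h \<cdot> \<iota> i"
      by (rule ihom_Hom_eq[OF a y cmp_Hom[OF \<iota>[OF i] h'(1)] cmp_Hom[OF \<iota>[OF i] h(1)]])
  qed
  then show ?thesis
    using h(2) h'(2) by simp
qed

text \<open>The identity and the zero arrow of \<open>c \<boxtimes> a\<close> agree after
  composition with each \<open>\<iota> i \<odot> idm C a\<close>, because that arrow starts at a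
  zero object. Joint epicity makes them equal.\<close>

lemma coproduct_tensor_zero_object:
  assumes cop: "coproduct C I t c \<iota>" and a: "a \<in> Ob C"
    and zero: "\<And>i. i \<in> I \<Longrightarrow> zero_object C (t i \<boxtimes> a)"
  shows "zero_object C (c \<boxtimes> a)"
proof -
  have c: "c \<in> Ob C" and \<iota>: "\<And>i. i \<in> I \<Longrightarrow> \<iota> i \<in> Hom C (t i) c"
    using cop unfolding coproduct_def by auto
  note ca = tno_Ob[OF c a]
  have "idm C (c \<boxtimes> a) = zerm C (c \<boxtimes> a) (c \<boxtimes> a)"
  proof (rule coproduct_tensor_Hom_eq[OF cop a idm_Hom[OF ca] zerm_Hom[OF ca ca]])
    fix i assume i: "i \<in> I"
    note k = tna_Hom[OF \<iota>[OF i] idm_Hom[OF a]]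
    show "idm C (c \<boxtimes> a) \<cdot> (\<iota> i \<odot> idm C a) = zerm C (c \<boxtimes> a) (c \<boxtimes> a) \<cdot> (\<iota> i \<odot> idm C a)"
      using zero_object_Hom_eq(1)[OF zero[OF i] cmp_Hom[OF k idm_Hom[OF ca]]
        cmp_Hom[OF k zerm_Hom[OF ca ca]]] .
  qed
  then show ?thesis
    using ca by (simp add: zero_object_iff)
qed

section \<open>Annihilator ideals and minimality\<close>

lemma localizing_ideal_annihilator:
  assumes a: "a \<in> Ob C"
  shows "localizing_ideal C {x \<in> Ob C. zero_object C (x \<boxtimes> a)}" (is "localizing_ideal C ?L")
  unfolding localizing_ideal_def localizing_def triangulated_subcategory_def
proof (intro conjI)
  obtain z where "zero_object C z"
    using ex_zero_object by blast
  then show "\<exists>z\<in>?L. zero_object C z"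
    using zero_object_tno_left[OF _ a] by (auto simp: zero_object_iff)
  show "\<forall>x\<in>?L. \<forall>y. isomorphic C x y \<longrightarrow> y \<in> ?L"
  proof (intro ballI allI impI)
    fix x y assume x: "x \<in> ?L" and iso: "isomorphic C x y"
    have "y \<in> Ob C"
      using iso Hom_Ob unfolding isomorphic_def iso_arrow_def by blast
    then show "y \<in> ?L"
      using x zero_object_isomorphic[OF isomorphic_tno_left[OF iso a]] by simp
  qed
  \<comment> \<open>The comparison \<open>tsh\<close> identifies \<open>sh C x \<boxtimes> a\<close>
    with the suspension of \<open>x \<boxtimes> a\<close>, and suspension reflects and preserves
    zero objects.\<close>
  show "\<forall>x\<in>Ob C. (sh C x \<in> ?L) = (x \<in> ?L)"
    using a sh_Ob zero_object_isomorphic[OF isomorphic_tsh] zero_object_sh tno_Ob by simp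
  show "\<forall>x y z u v w. exact_triangle C x y z u v w \<and> x \<in> ?L \<and> y \<in> ?L \<longrightarrow> z \<in> ?L"
  proof (intro allI impI)
    fix x y z u v w
    assume *: "exact_triangle C x y z u v w \<and> x \<in> ?L \<and> y \<in> ?L"
    then have "z \<in> Ob C"
      using Hom_Ob unfolding exact_triangle_def by blast
    moreover have "zero_object C (z \<boxtimes> a)"
      using * exact_triangle_zero_object exact_triangle_tensor[OF _ a] by blast
    ultimately show "z \<in> ?L"
      by simp
  qed
  show "\<forall>I t c \<iota>. small C I \<and> (\<forall>i\<in>I. t i \<in> ?L) \<and> coproduct C I t c \<iota> \<longrightarrow> c \<in> ?L"
  proof (intro allI impI)
    fix I t c \<iota>
    assume *: "small C I \<and> (\<forall>i\<in>I. t i \<in> ?L) \<and> coproduct C I t c \<iota>"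
    then have "zero_object C (c \<boxtimes> a)"
      using coproduct_tensor_zero_object[OF _ a] by blast
    then show "c \<in> ?L"
      using * unfolding coproduct_def by blast
  qed
  \<comment> \<open>Associativity turns \<open>(s \<boxtimes> x) \<boxtimes> a\<close> into
    \<open>s \<boxtimes> (x \<boxtimes> a)\<close>, whose right factor is zero.\<close>
  show "\<forall>s\<in>Ob C. \<forall>x\<in>?L. s \<boxtimes> x \<in> ?L"
    using a tno_Ob zero_object_isomorphic[OF isomorphic_assoc] zero_object_tno_right by simp
qed blast

text \<open>Minimality of \<open>M\<close> drives the direction from left to right. The converse is
  formal: tensoring preserves zero objects, and associativity and symmetry bring the vanishing
  factors together.\<close>

lemma minimal_localizing_ideal_tensor:
  assumes min: "minimal_localizing_ideal C M" and g: "g \<in> M"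
    and t1: "t1 \<in> Ob C" and t2: "t2 \<in> Ob C"
  shows "zero_object C (g \<boxtimes> (t1 \<boxtimes> t2)) \<longleftrightarrow> zero_object C (g \<boxtimes> t1) \<or> zero_object C (g \<boxtimes> t2)"
proof -
  have M: "localizing_ideal C M"
    using min unfolding minimal_localizing_ideal_def by blast
  note M_tri = localizing_idealD(1)[OF M]
  have gob: "g \<in> Ob C"
    using g localizing_idealD(2)[OF M] by blast
  \<comment> \<open>The ideal condition multiplies on the left, giving
    \<open>t1 \<boxtimes> g\<close>; the braiding and repleteness give the order wanted
    here.\<close>
  have gt1: "g \<boxtimes> t1 \<in> M"
    using triangulated_subcategoryD(3)[OF M_tri localizing_idealD(4)[OF M t1 g]
      isomorphic_braid[OF t1 gob]] .
  have assoc: "zero_object C (g \<boxtimes> (t1 \<boxtimes> t2)) \<longleftrightarrow> zero_object C ((g \<boxtimes> t1) \<boxtimes> t2)"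
    using zero_object_isomorphic[OF isomorphic_assoc[OF gob t1 t2]] by simp
  show ?thesis
  proof (intro iffI)
    assume "zero_object C (g \<boxtimes> (t1 \<boxtimes> t2))"
    then have zero: "zero_object C ((g \<boxtimes> t1) \<boxtimes> t2)"
      using assoc by simp
    let ?L = "{x \<in> Ob C. zero_object C (x \<boxtimes> t2)}"
    have "localizing_ideal C (?L \<inter> M)"
      using localizing_ideal_Int[OF localizing_ideal_annihilator[OF t2] M] .
    \<comment> \<open>If the intersection is zero, its element \<open>g \<boxtimes> t1\<close> is a
      zero object. If it is all of \<open>M\<close>, then \<open>g\<close> lies in
      \<open>?L\<close>, which says that \<open>g \<boxtimes> t2\<close> is a zero object.\<close>
    then have "?L \<inter> M = {z. zero_object C z} \<or> ?L \<inter> M = M"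
      using min unfolding minimal_localizing_ideal_def by blast
    moreover have "g \<boxtimes> t1 \<in> ?L \<inter> M"
      using zero gt1 tno_Ob gob t1 by simp
    ultimately show "zero_object C (g \<boxtimes> t1) \<or> zero_object C (g \<boxtimes> t2)"
      using g by blast
  next
    assume "zero_object C (g \<boxtimes> t1) \<or> zero_object C (g \<boxtimes> t2)"
    then show "zero_object C (g \<boxtimes> (t1 \<boxtimes> t2))"
    proof
      assume "zero_object C (g \<boxtimes> t1)"
      then show ?thesis
        using assoc zero_object_tno_left[OF _ t2] by simp
    next
      assume "zero_object C (g \<boxtimes> t2)"
      \<comment> \<open>Tensoring on the left with \<open>t1\<close> keeps \<open>g\<close> next to
        \<open>t2\<close>; reassociating and then swapping \<open>t1\<close> with \<open>g\<close>
        leads to \<open>(g \<boxtimes> t1) \<boxtimes> t2\<close>.\<close>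
      then have "zero_object C (t1 \<boxtimes> (g \<boxtimes> t2))"
        by (rule zero_object_tno_right[OF t1])
      then have "zero_object C ((t1 \<boxtimes> g) \<boxtimes> t2)"
        using zero_object_isomorphic[OF isomorphic_assoc[OF t1 gob t2]] by simp
      then show ?thesis
        using assoc zero_object_isomorphic[OF isomorphic_tno_left[OF isomorphic_braid[OF t1 gob] t2]]
        by simp
    qed
  qed
qed

end

section \<open>The support of a tensor product\<close>

theorem theorem8p2:
  fixes T :: "('u, 'o, 'm) ttcat"
  assumes "rigidly_compactly_generated T"
    and "weakly_noetherian (Spc_topology T)"
    and "stratified T"
    and "t1 \<in> Ob T" and "t2 \<in> Ob T"
  shows "Supp T (t1 \<boxtimes>\<^bsub>T\<^esub> t2) = Supp T t1 \<inter> Supp T t2"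
proof -
  interpret tt_category T
    using assms(1) unfolding rigidly_compactly_generated_def by blast
  have "zero_object T (point_idempotent T P \<boxtimes>\<^bsub>T\<^esub> (t1 \<boxtimes>\<^bsub>T\<^esub> t2)) \<longleftrightarrow>
      zero_object T (point_idempotent T P \<boxtimes>\<^bsub>T\<^esub> t1) \<or> zero_object T (point_idempotent T P \<boxtimes>\<^bsub>T\<^esub> t2)"
    if "P \<in> Spc T" for P
  \<comment> \<open>The ideal \<open>M\<close> is the one generated by the chosen representative of
    g(P), and \<open>g\<close> is that generator; stratification makes \<open>M\<close>
    minimal.\<close>
  proof (rule minimal_localizing_ideal_tensor[OF _ _ assms(4,5)])
    show "minimal_localizing_ideal T (Loc_ideal T {point_idempotent T P})"
      using assms(3) that unfolding stratified_def by blast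
    show "point_idempotent T P \<in> Loc_ideal T {point_idempotent T P}"
      unfolding Loc_ideal_def by blast
  qed
  \<comment> \<open>Negating the equivalence at each point turns the disjunction of vanishing
    conditions into the intersection of supports.\<close>
  then show ?thesis
    unfolding Supp_def by blast
qed

end
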